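(* Let $k>0$ be a constant. For any constant states $(u_b,\sigma_b)\in\mathbb{R}^2$ and $(u_0,\sigma_0)\in\mathbb{R}^2$ there exists a solution $(u,\sigma)$ in $\{(x,t): x>0,\ t>0\}$ (in the sense of the Volpert product, with shocks satisfying the Lax condition) of the system $$\frac{\partial u}{\partial t}+u\frac{\partial u}{\partial x}-\frac{\partial \sigma}{\partial x}=0,\qquad \frac{\partial \sigma}{\partial t}+u\frac{\partial \sigma}{\partial x}-k^2\frac{\partial u}{\partial x}=0,$$ with initial condition $$(u(x,0),\sigma(x,0))=(u_0,\sigma_0),\qquad x>0,$$ and boundary condition $$(u(0+,t),\sigma(0+,t))\in \mathcal{ER}(u_b,\sigma_b),\qquad t>0,$$ where $\mathcal{ER}(u_b,\sigma_b)$ is the set of admissible boundary values based on the Riemann problem. Moreover, this solution consists of simple shock waves and rarefaction waves separated by constant states.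
   Context: The system is written as $(u,\sigma)^T_t+A(u,\sigma)(u,\sigma)^T_x=0$ with $A(u,\sigma)=\begin{bmatrix}u&-1\\-k^2&u\end{bmatrix}$, $k>0$. Its eigenvalues (characteristic speeds) are $\lambda_1(u,\sigma)=u-k$ and $\lambda_2(u,\sigma)=u+k$, with right eigenvectors $r_1=(1,k)$ and $r_2=(1,-k)$. The system is nonconservative. Solutions are understood with the Volpert product for the nonconservative terms: a piecewise smooth function is a solution if it satisfies the system classically where it is smooth and satisfies the Rankine-Hugoniot conditions below across each discontinuity. Discontinuities are required to be Lax admissible. Shock waves. A shock wave with speed $s$ is a solution of the form $(u,\sigma)(x,t)=(u_-,\sigma_-)$ for $x<st$ and $(u,\sigma)(x,t)=(u_+,\sigma_+)$ for $x>st$, where the Rankine-Hugoniot conditions for the Volpert product hold: $$-s(u_+-u_-)+\frac{u_+^2-u_-^2}{2}-(\sigma_+-\sigma_-)=0,$$ $$-s(\sigma_+-\sigma_-)+\frac{u_++u_-}{2}(\sigma_+-\sigma_-)-k^2(u_+-u_-)=0.$$ For $j=1,2$, a $j$-shock has speed $s_j=\frac{u_++u_-}{2}+(-1)^jk$, and Lax admissibility means $\lambda_j(u_+,\sigma_+)\le s_j\le\lambda_j(u_-,\sigma_-)$. Rarefaction waves. A $j$-rarefaction wave is a continuous solution of the form $(u,\sigma)(x,t)=(u_-,\sigma_-)$ for $x<\lambda_j(u_-,\sigma_-)t$, $(u,\sigma)(x,t)=(\bar u(x/t),\bar\sigma(x/t))$ for $\lambda_j(u_-,\sigma_-)t<x<\lambda_j(u_+,\sigma_+)t$,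 and $(u,\sigma)(x,t)=(u_+,\sigma_+)$ for $x>\lambda_j(u_+,\sigma_+)t$, with $\xi\mapsto\lambda_j(\bar u(\xi),\bar\sigma(\xi))$ increasing. Explicitly, $\bar u(\xi)=\xi+k$, $\bar\sigma(\xi)=k\xi+c$ for $j=1$, and $\bar u(\xi)=\xi-k$, $\bar\sigma(\xi)=-k\xi+c$ for $j=2$, with $c$ a constant. Wave curves. For a fixed left state $(u_-,\sigma_-)$, the right states $(u,\sigma)$ that can be joined to it by a single wave are: 1-rarefaction: $\sigma=\sigma_-+k(u-u_-)$, $u>u_-$; 1-shock: $\sigma=\sigma_-+k(u-u_-)$, $u<u_-$; 2-rarefaction: $\sigma=\sigma_--k(u-u_-)$, $u>u_-$; 2-shock: $\sigma=\sigma_--k(u-u_-)$, $u<u_-$. Riemann problem. For states $(u_-,\sigma_-),(u_+,\sigma_+)\in\mathbb{R}^2$, $R((u_-,\sigma_-),(u_+,\sigma_+))(x/t)$ denotes the self-similar solution on $x\in\mathbb{R}$, $t>0$, of the system with initial data $(u_-,\sigma_-)$ for $x<0$ and $(u_+,\sigma_+)$ for $x>0$, in the class of functions consisting of Lax admissible shock waves and rarefaction waves separated by constant states: $(u_-,\sigma_-)$ is joined to an intermediate constant state by a 1-wave, and that state is joined to $(u_+,\sigma_+)$ by a 2-wave (either wave may be trivial). The paper relies on the assertion, which it recalls from earlier literature, that this Riemann problem is uniquely solvable in this class for arbitrary pairs of states. Admissible boundary values. For $(u_b,\sigma_b)\in\mathbb{R}^2$, $$\mathcal{ER}(u_b,\sigma_b)=\left\{R((u_b,\sigma_b),(\bar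 u,\bar\sigma))\left(\tfrac{x}{t}\right)\Big|_{x=0}\ :\ (\bar u,\bar\sigma)\in\mathbb{R}^2\right\},$$ where the value at $x=0$ is taken as the limit $x\to0+$ (relevant only when the Riemann solution has a discontinuity at $x=0$). The notation $u(0+,t),\sigma(0+,t)$ means the limit as $x\to0+$ for fixed $t>0$. In the domain $x>0$, $t>0$, shock and rarefaction waves are understood as restricted to $x>0$.
   Formalization: Assumes the Riemann problem from (u_b,σ_b) to (u_0,σ_0) is solvable by waves separated by nonempty constant regions; false for large data, e.g. k=1, (10,0), (-10,0), where no solution exists. Only the coincidence u_b=3k with a stationary 1-shock touching a 2-rarefaction is lost. *)

theory Defs
  imports "HOL-Analysis.Analysis"
begin

text \<open>
  A state is a pair \<open>(u, \<sigma>)\<close>; a point of the half plane or quarter plane is a pair \<open>(x, t)\<close>.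
  Families are numbered by \<open>j \<in> {1, 2}\<close>, so that \<open>(-1) ^ j * k\<close> is \<open>-k\<close> for \<open>j = 1\<close>
  and \<open>+k\<close> for \<open>j = 2\<close>.
\<close>

type_synonym state = "real \<times> real"

definition char_speed :: "real \<Rightarrow> nat \<Rightarrow> state \<Rightarrow> real" where
  "char_speed k j U = fst U + (-1) ^ j * k"

definition rankine_hugoniot :: "real \<Rightarrow> real \<Rightarrow> state \<Rightarrow> state \<Rightarrow> bool" where
  "rankine_hugoniot k s UL UR \<longleftrightarrow>
     (let (ul, \<sigma>l) = UL; (ur, \<sigma>r) = UR in
        - s * (ur - ul) + (ur\<^sup>2 - ul\<^sup>2) / 2 - (\<sigma>r - \<sigma>l) = 0 \<and>
        - s * (\<sigma>r - \<sigma>l) + (ur + ul) / 2 * (\<sigma>r - \<sigma>l) - k\<^sup>2 * (ur - ul) = 0)"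

definition lax_shock :: "real \<Rightarrow> nat \<Rightarrow> real \<Rightarrow> state \<Rightarrow> state \<Rightarrow> bool" where
  "lax_shock k j s UL UR \<longleftrightarrow>
     j \<in> {1, 2} \<and> UL \<noteq> UR \<and> rankine_hugoniot k s UL UR \<and>
     s = (fst UR + fst UL) / 2 + (-1) ^ j * k \<and>
     char_speed k j UR \<le> s \<and> s \<le> char_speed k j UL"

text \<open>
  Piecewise smooth solutions for the Volpert product on an open set \<open>\<Omega>\<close>. The finitely many
  curves \<open>x = \<gamma> t\<close> contain all points where \<open>U\<close> is not continuously differentiable: shock curves,
  where the one-sided limits differ, and weak discontinuities such as the edges of a rarefaction
  wave, where \<open>U\<close> is continuous. The value of \<open>U\<close> on a shock curve is immaterial.
\<close>

definition volpert_solution :: "real \<Rightarrow> (real \<times> real) set \<Rightarrow> (real \<times> real \<Rightarrow> state) \<Rightarrow> bool" where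
  "volpert_solution k \<Omega> U \<longleftrightarrow>
     (\<exists>\<Gamma> :: (real \<Rightarrow> real) set.
        finite \<Gamma> \<and>
        (\<forall>\<gamma>\<in>\<Gamma>. \<gamma> differentiable_on UNIV \<and> continuous_on UNIV (deriv \<gamma>)) \<and>
        (let S = \<Omega> - {(x, t). \<exists>\<gamma>\<in>\<Gamma>. x = \<gamma> t} in
          \<exists>ux ut \<sigma>x \<sigma>t :: real \<times> real \<Rightarrow> real.
            continuous_on S ux \<and> continuous_on S ut \<and>
            continuous_on S \<sigma>x \<and> continuous_on S \<sigma>t \<and>
            (\<forall>p\<in>S.
               ((\<lambda>q. fst (U q)) has_derivative (\<lambda>(dx, dt). ux p * dx + ut p * dt)) (at p) \<and>
               ((\<lambda>q. snd (U q)) has_derivative (\<lambda>(dx, dt). \<sigma>x p * dx + \<sigma>t p * dt)) (at p) \<and>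
               ut p + fst (U p) * ux p - \<sigma>x p = 0 \<and>
               \<sigma>t p + fst (U p) * \<sigma>x p - k\<^sup>2 * ux p = 0)) \<and>
        (\<forall>\<gamma>\<in>\<Gamma>. \<forall>t. (\<gamma> t, t) \<in> \<Omega> \<longrightarrow>
           (\<exists>UL UR.
              (U \<longlongrightarrow> UL) (at (\<gamma> t, t) within {(y, \<tau>). y < \<gamma> \<tau>}) \<and>
              (U \<longlongrightarrow> UR) (at (\<gamma> t, t) within {(y, \<tau>). \<gamma> \<tau> < y}) \<and>
              (if UL = UR then U (\<gamma> t, t) = UL
               else \<exists>j. lax_shock k j (deriv \<gamma> t) UL UR))))"

text \<open>Waves are described by their profiles in the similarity variable \<open>\<xi> = x / t\<close>.\<close>

definition shock_wave :: "real \<Rightarrow> nat \<Rightarrow> state \<Rightarrow> state \<Rightarrow> (real \<Rightarrow> state) \<Rightarrow> bool" where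
  "shock_wave k j UL UR W \<longleftrightarrow>
     (\<exists>s. lax_shock k j s UL UR \<and> (\<forall>\<xi><s. W \<xi> = UL) \<and> (\<forall>\<xi>>s. W \<xi> = UR))"

text \<open>
  Inside the fan the formula gives \<open>char_speed k j (W \<xi>) = \<xi>\<close>, which is increasing.
  Continuity at the two edges determines \<open>c\<close> and forces \<open>UR\<close> to lie on the wave curve of \<open>UL\<close>.
\<close>

definition rarefaction_wave :: "real \<Rightarrow> nat \<Rightarrow> state \<Rightarrow> state \<Rightarrow> (real \<Rightarrow> state) \<Rightarrow> bool" where
  "rarefaction_wave k j UL UR W \<longleftrightarrow>
     j \<in> {1, 2} \<and> char_speed k j UL < char_speed k j UR \<and> continuous_on UNIV W \<and>
     (\<forall>\<xi><char_speed k j UL. W \<xi> = UL) \<and>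
     (\<exists>c. \<forall>\<xi>\<in>{char_speed k j UL <..< char_speed k j UR}.
        W \<xi> = (\<xi> - (-1) ^ j * k, - ((-1) ^ j * k * \<xi>) + c)) \<and>
     (\<forall>\<xi>>char_speed k j UR. W \<xi> = UR)"

text \<open>
  \<open>wave_fan k js UL UR V\<close>: the profile \<open>V\<close> runs from \<open>UL\<close> to \<open>UR\<close> through waves of the families
  listed in \<open>js\<close>, from left to right. Consecutive waves are glued along an interval \<open>{c<..<d}\<close> on
  which both have the common constant value \<open>UM\<close>; this is where the ordering of the wave speeds
  enters.
\<close>

inductive wave_fan :: "real \<Rightarrow> nat list \<Rightarrow> state \<Rightarrow> state \<Rightarrow> (real \<Rightarrow> state) \<Rightarrow> bool" for k where
  no_wave: "wave_fan k [] U U (\<lambda>_. U)"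
| add_wave: "wave_fan k js UL UM V \<Longrightarrow> shock_wave k j UM UR W \<or> rarefaction_wave k j UM UR W \<Longrightarrow>
     c < d \<Longrightarrow> (\<forall>\<xi>>c. V \<xi> = UM) \<Longrightarrow> (\<forall>\<xi><d. W \<xi> = UM) \<Longrightarrow>
     wave_fan k (js @ [j]) UL UR (\<lambda>\<xi>. if \<xi> < d then V \<xi> else W \<xi>)"

text \<open>
  A relation rather than a function: two profiles for the same data may differ at the jumps, and
  for some pairs of states there is none, because the 1-wave and the 2-wave given by the wave
  curves do not have increasing speeds. For two shocks, for instance, the speeds are ordered only
  if \<open>fst UL - fst UR < 4 * k\<close>.
\<close>

definition riemann_solution :: "real \<Rightarrow> state \<Rightarrow> state \<Rightarrow> (real \<Rightarrow> state) \<Rightarrow> bool" where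
  "riemann_solution k UL UR V \<longleftrightarrow> (\<exists>js\<in>{[], [1], [2], [1, 2]}. wave_fan k js UL UR V)"

definition ER :: "real \<Rightarrow> state \<Rightarrow> state set" where
  "ER k Ub = {v. \<exists>Ubar V. riemann_solution k Ub Ubar V \<and> (V \<longlongrightarrow> v) (at_right 0)}"

definition quarter_plane :: "(real \<times> real) set" where
  "quarter_plane = {(x, t). 0 < x \<and> 0 < t}"

definition initial_condition :: "(real \<times> real \<Rightarrow> state) \<Rightarrow> state \<Rightarrow> bool" where
  "initial_condition U U0 \<longleftrightarrow>
     (\<forall>x>0. U (x, 0) = U0 \<and> (U \<longlongrightarrow> U0) (at (x, 0) within quarter_plane))"

definition boundary_condition :: "real \<Rightarrow> (real \<times> real \<Rightarrow> state) \<Rightarrow> state \<Rightarrow> bool" where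
  "boundary_condition k U Ub \<longleftrightarrow>
     (\<forall>t>0. \<exists>v\<in>ER k Ub. ((\<lambda>x. U (x, t)) \<longlongrightarrow> v) (at_right 0))"

definition consists_of_waves :: "real \<Rightarrow> (real \<times> real \<Rightarrow> state) \<Rightarrow> bool" where
  "consists_of_waves k U \<longleftrightarrow>
     (\<exists>js UL UR V. wave_fan k js UL UR V \<and> (\<forall>x>0. \<forall>t>0. U (x, t) = V (x / t)))"

end

(* The self-similar function V (x / t), with V the assumed Riemann profile from the boundary state
   to the initial state, restricted to x > 0, is the solution: its boundary value lies in ER
   because V itself is one of the Riemann solutions defining ER.  What has to be checked is that a
   wave fan is a Volpert solution.  This is local in x / t: away from finitely many speeds a
   profile is affine, and at those speeds it is either continuous or has a Lax shock. *)

theory Submission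
  imports Defs
begin

section \<open>Local description of self-similar profiles\<close>

text \<open>Inserting \<open>V (x / t)\<close> into the system gives (A(V) - \<xi>) V' = 0. The two
  products are the rows of this equation, so the slope \<open>b\<close> is zero or an eigenvector of
  A(V) for the eigenvalue \<xi>. An affine form is enough because constant states and rarefaction
  fans are both affine in \<xi>.\<close>

definition regular_at :: "real \<Rightarrow> (real \<Rightarrow> state) \<Rightarrow> real \<Rightarrow> bool" where
  "regular_at k V \<xi> \<longleftrightarrow>
     (\<exists>a b. \<forall>\<^sub>F \<eta> in nhds \<xi>. V \<eta> = a + \<eta> *\<^sub>R b \<and>
        (fst (V \<eta>) - \<eta>) * fst b = snd b \<and> (fst (V \<eta>) - \<eta>) * snd b = k\<^sup>2 * fst b)"

text \<open>This is the clause of \<open>volpert_solution\<close> for a single curve, carried over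
  to the ray \<open>x = s * t\<close>. It covers shocks as well as the edges of a fan, where the two
  limits coincide.\<close>

definition admissible_jump_at :: "real \<Rightarrow> (real \<Rightarrow> state) \<Rightarrow> real \<Rightarrow> bool" where
  "admissible_jump_at k V s \<longleftrightarrow>
     (\<exists>UL UR. (V \<longlongrightarrow> UL) (at_left s) \<and> (V \<longlongrightarrow> UR) (at_right s) \<and>
        (if UL = UR then V s = UL else \<exists>j. lax_shock k j s UL UR))"

text \<open>Finiteness is asked because every irregular speed later contributes one ray to the
  finite set of curves in \<open>volpert_solution\<close>.\<close>

definition admissible_profile :: "real \<Rightarrow> (real \<Rightarrow> state) \<Rightarrow> bool" where
  "admissible_profile k V \<longleftrightarrow>
     finite {\<xi>. \<not> regular_at k V \<xi>} \<and>
     (\<forall>\<xi>. regular_at k V \<xi> \<or> admissible_jump_at k V \<xi>)"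

lemma regular_at_cong:
  assumes "\<forall>\<^sub>F \<eta> in nhds \<xi>. V \<eta> = W \<eta>" "regular_at k W \<xi>"
  shows "regular_at k V \<xi>"
proof -
  obtain a b where "\<forall>\<^sub>F \<eta> in nhds \<xi>. W \<eta> = a + \<eta> *\<^sub>R b \<and>
        (fst (W \<eta>) - \<eta>) * fst b = snd b \<and> (fst (W \<eta>) - \<eta>) * snd b = k\<^sup>2 * fst b"
    using assms(2) unfolding regular_at_def by blast
  with assms(1) have "\<forall>\<^sub>F \<eta> in nhds \<xi>. V \<eta> = a + \<eta> *\<^sub>R b \<and>
        (fst (V \<eta>) - \<eta>) * fst b = snd b \<and> (fst (V \<eta>) - \<eta>) * snd b = k\<^sup>2 * fst b"
    by eventually_elim (elim conjE, simp)
  then show ?thesis unfolding regular_at_def by blast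
qed

text \<open>The agreement is stated with \<open>nhds\<close>, which includes \<open>s\<close>
  itself, because the value at \<open>s\<close> enters when the two limits coincide.\<close>

lemma admissible_jump_at_cong:
  assumes ev: "\<forall>\<^sub>F \<eta> in nhds s. V \<eta> = W \<eta>" and W: "admissible_jump_at k W s"
  shows "admissible_jump_at k V s"
proof -
  have "(V \<longlongrightarrow> L) (at s within A) \<longleftrightarrow> (W \<longlongrightarrow> L) (at s within A)" for L A
    by (intro filterlim_cong refl)
      (use ev in \<open>auto simp: eventually_at_filter elim: eventually_mono\<close>)
  moreover have "V s = W s"
    using ev by (rule eventually_nhds_x_imp_x)
  ultimately show ?thesis
    using W unfolding admissible_jump_at_def by (simp only: simp_thms)
qed

lemma eventually_nhds_open:
  assumes "open A" "x \<in> A" "\<And>y. y \<in> A \<Longrightarrow> P y"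
  shows "\<forall>\<^sub>F y in nhds x. P y"
  using assms unfolding eventually_nhds by blast

lemma regular_at_constant:
  assumes "open A" "\<xi> \<in> A" "\<And>\<eta>. \<eta> \<in> A \<Longrightarrow> V \<eta> = U"
  shows "regular_at k V \<xi>"
  unfolding regular_at_def
  by (rule exI[of _ U], rule exI[of _ 0], rule eventually_nhds_open[OF assms(1,2)])
    (simp add: assms(3))

section \<open>Profiles of single waves and of wave fans\<close>

lemma admissible_profile_shock:
  assumes "shock_wave k j UL UR W"
  shows "admissible_profile k W"
proof -
  obtain s where s: "lax_shock k j s UL UR" "\<And>\<xi>. \<xi> < s \<Longrightarrow> W \<xi> = UL" "\<And>\<xi>. \<xi> > s \<Longrightarrow> W \<xi> = UR"
    using assms unfolding shock_wave_def by blast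
  have reg: "regular_at k W \<xi>" if "\<xi> \<noteq> s" for \<xi>
  proof (cases "\<xi> < s")
    case True
    then show ?thesis using s by (intro regular_at_constant[of "{..<s}" _ _ UL]) auto
  next
    case False
    then show ?thesis using s that by (intro regular_at_constant[of "{s<..}" _ _ UR]) auto
  qed
  \<comment> \<open>\<open>shock_wave\<close> leaves \<open>W s\<close> open. Since the two states
    differ, only the Lax branch has to be shown, and it does not mention that value.\<close>
  have "UL \<noteq> UR" using s(1) by (simp add: lax_shock_def)
  moreover have "(W \<longlongrightarrow> UL) (at_left s)"
    by (rule tendsto_eventually) (auto simp: eventually_at_filter s)
  moreover have "(W \<longlongrightarrow> UR) (at_right s)"
    by (rule tendsto_eventually) (auto simp: eventually_at_filter s)
  ultimately have "admissible_jump_at k W s"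
    unfolding admissible_jump_at_def using s(1) by (metis (full_types))
  moreover have "finite {\<xi>. \<not> regular_at k W \<xi>}"
    by (rule finite_subset[of _ "{s}"]) (use reg in auto)
  ultimately show ?thesis
    unfolding admissible_profile_def using reg by metis
qed

text \<open>Inside the fan \<open>fst (W \<eta>) - \<eta>\<close> is the constant
  \<open>- m\<close>, so both equations of \<open>regular_at\<close> reduce to
  \<open>m * m = k\<^sup>2\<close>, which holds for either sign of \<open>m\<close>.\<close>

lemma admissible_profile_rarefaction:
  assumes "rarefaction_wave k j UL UR W"
  shows "admissible_profile k W"
proof -
  define l r where "l = char_speed k j UL" and "r = char_speed k j UR"
  define m where "m = (-1) ^ j * k"
  have m2: "m * m = k\<^sup>2"
    by (simp add: m_def power2_eq_square minus_one_power_iff)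
  obtain c where W: "continuous_on UNIV W" "\<And>\<xi>. \<xi> < l \<Longrightarrow> W \<xi> = UL" "\<And>\<xi>. \<xi> > r \<Longrightarrow> W \<xi> = UR"
    "\<And>\<xi>. l < \<xi> \<Longrightarrow> \<xi> < r \<Longrightarrow> W \<xi> = (\<xi> - m, - (m * \<xi>) + c)"
    using assms unfolding rarefaction_wave_def l_def r_def m_def by auto
  have reg: "regular_at k W \<xi>" if "\<xi> \<noteq> l" "\<xi> \<noteq> r" for \<xi>
  proof -
    have "l < r" using assms by (simp add: rarefaction_wave_def l_def r_def)
    then consider "\<xi> < l" | "\<xi> > r" | "l < \<xi>" "\<xi> < r" using \<open>\<xi> \<noteq> l\<close> \<open>\<xi> \<noteq> r\<close> by linarith
    then show ?thesis
    proof cases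
      case 1
      then show ?thesis using W by (intro regular_at_constant[of "{..<l}" _ _ UL]) auto
    next
      case 2
      then show ?thesis using W by (intro regular_at_constant[of "{r<..}" _ _ UR]) auto
    next
      case 3
      \<comment> \<open>The slope \<open>(1, - m)\<close> is the right eigenvector of the family:
        (1, k) for j = 1 and (1, -k) for j = 2.\<close>
      have "\<forall>\<^sub>F \<eta> in nhds \<xi>. W \<eta> = (- m, c) + \<eta> *\<^sub>R (1, - m) \<and>
          (fst (W \<eta>) - \<eta>) * fst (1, - m) = snd (1::real, - m) \<and>
          (fst (W \<eta>) - \<eta>) * snd (1::real, - m) = k\<^sup>2 * fst (1, - m)"
        by (rule eventually_nhds_open[of "{l<..<r}"]) (use 3 in \<open>auto simp: W(4) m2\<close>)
      then show ?thesis unfolding regular_at_def by blast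
    qed
  qed
  \<comment> \<open>At the edges \<open>l\<close> and \<open>r\<close> the slope jumps, but
    continuity makes both one-sided limits equal to the value there.\<close>
  have "isCont W \<xi>" for \<xi>
    using W(1) by (simp add: continuous_on_eq_continuous_at)
  then have "(W \<longlongrightarrow> W \<xi>) (at \<xi> within A)" for \<xi> A
    by (metis continuous_at_imp_continuous_at_within continuous_within)
  then have "admissible_jump_at k W \<xi>" for \<xi>
    unfolding admissible_jump_at_def by (intro exI[of _ "W \<xi>"]) simp
  moreover have "finite {\<xi>. \<not> regular_at k W \<xi>}"
    by (rule finite_subset[of _ "{l, r}"]) (use reg in auto)
  ultimately show ?thesis
    unfolding admissible_profile_def by blast
qed

text \<open>The two profiles agree on the overlap between \<open>c\<close> and \<open>d\<close>, so
  near every point the glued profile coincides with one of them, and both regularity and admissible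
  jumps are local.\<close>

lemma admissible_profile_glue:
  assumes V: "admissible_profile k V" and W: "admissible_profile k W" and "c < d"
    and VM: "\<And>\<xi>. \<xi> > c \<Longrightarrow> V \<xi> = UM" and WM: "\<And>\<xi>. \<xi> < d \<Longrightarrow> W \<xi> = UM"
  shows "admissible_profile k (\<lambda>\<xi>. if \<xi> < d then V \<xi> else W \<xi>)" (is "admissible_profile k ?G")
proof -
  have local: "(\<forall>\<^sub>F \<eta> in nhds \<xi>. ?G \<eta> = V \<eta>) \<or> (\<forall>\<^sub>F \<eta> in nhds \<xi>. ?G \<eta> = W \<eta>)" for \<xi>
  proof (cases "\<xi> < d")
    case True
    then have "\<forall>\<^sub>F \<eta> in nhds \<xi>. ?G \<eta> = V \<eta>"
      by (intro eventually_nhds_open[of "{..<d}"]) auto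
    then show ?thesis ..
  next
    case False
    \<comment> \<open>The open set has to reach below \<open>d\<close> to contain
      \<open>\<xi> = d\<close>; between \<open>c\<close> and \<open>d\<close> both profiles equal
      \<open>UM\<close>.\<close>
    then have "\<forall>\<^sub>F \<eta> in nhds \<xi>. ?G \<eta> = W \<eta>"
      using \<open>c < d\<close> by (intro eventually_nhds_open[of "{c<..}"]) (auto simp: VM WM)
    then show ?thesis ..
  qed
  have "regular_at k ?G \<xi>" if "regular_at k V \<xi>" "regular_at k W \<xi>" for \<xi>
    using local[of \<xi>] regular_at_cong that by meson
  then have "{\<xi>. \<not> regular_at k ?G \<xi>} \<subseteq>
      {\<xi>. \<not> regular_at k V \<xi>} \<union> {\<xi>. \<not> regular_at k W \<xi>}"
    by blast
  then have "finite {\<xi>. \<not> regular_at k ?G \<xi>}"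
    using V W unfolding admissible_profile_def by (meson finite_UnI finite_subset)
  moreover have "regular_at k ?G \<xi> \<or> admissible_jump_at k ?G \<xi>" for \<xi>
    using local[of \<xi>]
  proof
    assume eq: "\<forall>\<^sub>F \<eta> in nhds \<xi>. ?G \<eta> = V \<eta>"
    show ?thesis
      using V regular_at_cong[OF eq] admissible_jump_at_cong[OF eq]
      unfolding admissible_profile_def by blast
  next
    assume eq: "\<forall>\<^sub>F \<eta> in nhds \<xi>. ?G \<eta> = W \<eta>"
    show ?thesis
      using W regular_at_cong[OF eq] admissible_jump_at_cong[OF eq]
      unfolding admissible_profile_def by blast
  qed
  ultimately show ?thesis
    unfolding admissible_profile_def by blast
qed

lemma admissible_profile_wave_fan:
  assumes "wave_fan k js UL UR V"
  shows "admissible_profile k V"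
  using assms
proof induction
  case (no_wave U)
  have "regular_at k (\<lambda>_. U) \<xi>" for \<xi>
    by (rule regular_at_constant[of UNIV]) auto
  then show ?case by (simp add: admissible_profile_def)
next
  case (add_wave js UL UM V j UR W c d)
  then show ?case
    by (intro admissible_profile_glue[of k V W c d UM])
      (auto intro: admissible_profile_shock admissible_profile_rarefaction)
qed

text \<open>Only the last wave matters here, so a case distinction replaces induction. This gives
  the initial condition, because \<open>x / t\<close> exceeds any bound as t tends to 0 with x >
  0.\<close>

lemma wave_fan_right_state:
  assumes "wave_fan k js UL UR V"
  shows "\<exists>M. \<forall>\<xi>>M. V \<xi> = UR"
  using assms
proof cases
  case (add_wave js UM V' j W c d)
  then obtain M where "\<forall>\<xi>>M. W \<xi> = UR"
    unfolding shock_wave_def rarefaction_wave_def by blast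
  then show ?thesis
    using add_wave by (intro exI[of _ "max M d"]) auto
qed auto

section \<open>From profiles to solutions in the quarter plane\<close>

lemma regular_at_vector_derivative:
  assumes "regular_at k V \<xi>"
  obtains b where "(V has_vector_derivative b) (at \<xi>)"
    "\<forall>\<^sub>F \<eta> in nhds \<xi>. vector_derivative V (at \<eta>) = b"
    "(fst (V \<xi>) - \<xi>) * fst b = snd b" "(fst (V \<xi>) - \<xi>) * snd b = k\<^sup>2 * fst b"
proof -
  obtain a b where ab: "\<forall>\<^sub>F \<eta> in nhds \<xi>. V \<eta> = a + \<eta> *\<^sub>R b \<and>
        (fst (V \<eta>) - \<eta>) * fst b = snd b \<and> (fst (V \<eta>) - \<eta>) * snd b = k\<^sup>2 * fst b"
    using assms unfolding regular_at_def by blast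
  then obtain A where A: "open A" "\<xi> \<in> A" "\<And>\<eta>. \<eta> \<in> A \<Longrightarrow> V \<eta> = a + \<eta> *\<^sub>R b"
    unfolding eventually_nhds by blast
  have deriv: "(V has_vector_derivative b) (at \<eta>)" if "\<eta> \<in> A" for \<eta>
  proof (rule has_vector_derivative_transform_within_open[OF _ \<open>open A\<close> that])
    show "((\<lambda>\<eta>. a + \<eta> *\<^sub>R b) has_vector_derivative b) (at \<eta>)"
      by (auto intro!: derivative_eq_intros)
  qed (simp add: A)
  show ?thesis
  proof (rule that)
    show "(V has_vector_derivative b) (at \<xi>)" by (rule deriv[OF A(2)])
    \<comment> \<open>Local constancy of the derivative is recorded too: it yields continuity of the
      partial derivatives of the solution.\<close>
    show "\<forall>\<^sub>F \<eta> in nhds \<xi>. vector_derivative V (at \<eta>) = b"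
      by (rule eventually_nhds_open[OF A(1,2)]) (simp add: deriv vector_derivative_at)
  qed (use eventually_nhds_x_imp_x[OF ab] in auto)
qed

text \<open>Regular points are treated as continuous ones, so limits are available at every speed.
  This also serves for the boundary value, where the profile may jump at speed 0.\<close>

lemma admissible_profile_one_sided_limits:
  assumes "admissible_profile k V"
  obtains UL UR where "(V \<longlongrightarrow> UL) (at_left s)" "(V \<longlongrightarrow> UR) (at_right s)"
    "if UL = UR then V s = UL else \<exists>j. lax_shock k j s UL UR"
proof (cases "regular_at k V s")
  case True
  then obtain b where "(V has_vector_derivative b) (at s)"
    by (rule regular_at_vector_derivative)
  then have "(V \<longlongrightarrow> V s) (at s within A)" for A
    using has_vector_derivative_continuous tendsto_within_subset
    unfolding continuous_within by blast
  then show ?thesis by (intro that[of "V s" "V s"]) auto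
next
  case False
  then show ?thesis
    using assms that unfolding admissible_profile_def admissible_jump_at_def by blast
qed

text \<open>The quotient x / t turns an approach to a point of the ray within \<open>A\<close> into
  an approach to \<open>s\<close> within \<open>B\<close>. It must avoid \<open>s\<close> itself,
  since \<open>at s within B\<close> ignores the value there; strictly on one side of the ray this
  is automatic.\<close>

lemma tendsto_self_similar:
  fixes s t :: real
  assumes "(V \<longlongrightarrow> L) (at s within B)" "t > 0"
    and "\<And>q. q \<in> A \<Longrightarrow> snd q > 0 \<Longrightarrow> fst q / snd q \<in> B - {s}"
    and "\<And>q. snd q > 0 \<Longrightarrow> U q = V (fst q / snd q)"
  shows "(U \<longlongrightarrow> L) (at (s * t, t) within A)"
proof -
  have "((\<lambda>q. fst q / snd q) \<longlongrightarrow> fst (s * t, t) / snd (s * t, t)) (at (s * t, t) within A)"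
    using \<open>t > 0\<close> by (intro tendsto_divide tendsto_fst tendsto_snd tendsto_ident_at) auto
  then have lim: "((\<lambda>q. fst q / snd q) \<longlongrightarrow> s) (at (s * t, t) within A)"
    using \<open>t > 0\<close> by simp
  have "open {q :: real \<times> real. snd q > 0}"
    by (intro open_Collect_less continuous_intros)
  then have "\<forall>\<^sub>F q in nhds (s * t, t). snd q > 0"
    using \<open>t > 0\<close> by (intro eventually_nhds_open) auto
  then have pos: "\<forall>\<^sub>F q in at (s * t, t) within A. q \<in> A \<and> snd q > 0"
    by (auto simp: eventually_at_filter elim: eventually_mono)
  then have "\<forall>\<^sub>F q in at (s * t, t) within A. fst q / snd q \<in> B - {s}"
    by (rule eventually_mono) (use assms(3) in blast)
  with lim have "filterlim (\<lambda>q. fst q / snd q) (at s within B) (at (s * t, t) within A)"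
    unfolding filterlim_at by (auto elim: eventually_mono)
  then have "((\<lambda>q. V (fst q / snd q)) \<longlongrightarrow> L) (at (s * t, t) within A)"
    by (rule filterlim_compose[OF assms(1)])
  moreover have "\<forall>\<^sub>F q in at (s * t, t) within A. U q = V (fst q / snd q)"
    using pos by (rule eventually_mono) (use assms(4) in blast)
  ultimately show ?thesis
    by (simp add: tendsto_cong)
qed

lemma volpert_solution_self_similar:
  assumes V: "admissible_profile k V"
    and U: "\<And>q. snd q > 0 \<Longrightarrow> U q = V (fst q / snd q)"
  shows "volpert_solution k quarter_plane U"
proof -
  define P where "P = {\<xi>. \<not> regular_at k V \<xi>}"
  define \<Gamma> where "\<Gamma> = (\<lambda>s t::real. s * t) ` P"
  define S where "S = quarter_plane - {(x, t). \<exists>\<gamma>\<in>\<Gamma>. x = \<gamma> t}"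
  \<comment> \<open>\<open>D\<close> is V' at x / t; on \<open>S\<close> the irregular speeds, where
    this derivative may fail to exist, have been removed.\<close>
  define D where "D = (\<lambda>q::real\<times>real. vector_derivative V (at (fst q / snd q)))"
  have [simp]: "deriv (\<lambda>t. s * t) = (\<lambda>t. s)" for s :: real
    by (rule ext, rule DERIV_imp_deriv) (auto intro!: derivative_eq_intros)
  have S: "fst p > 0" "snd p > 0" "regular_at k V (fst p / snd p)" if "p \<in> S" for p
    using that by (auto simp: S_def \<Gamma>_def P_def quarter_plane_def)
  have contD: "continuous_on S D"
    unfolding continuous_on_def
  proof
    fix p assume p: "p \<in> S"
    obtain b where b: "\<forall>\<^sub>F \<eta> in nhds (fst p / snd p). vector_derivative V (at \<eta>) = b"
      using S(3)[OF p] by (rule regular_at_vector_derivative)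
    have "((\<lambda>q. fst q / snd q) \<longlongrightarrow> fst p / snd p) (at p within S)"
      using S[OF p] by (intro tendsto_divide tendsto_fst tendsto_snd tendsto_ident_at) auto
    then have "\<forall>\<^sub>F q in at p within S. D q = b"
      unfolding D_def by (rule eventually_compose_filterlim[OF b])
    moreover have "D p = b"
      unfolding D_def using b by (rule eventually_nhds_x_imp_x)
    ultimately show "(D \<longlongrightarrow> D p) (at p within S)"
      by (simp add: tendsto_eventually)
  qed
  \<comment> \<open>These are the chain rule expressions: x / t has partial derivatives 1 / t in x
    and - x / t^2 in t.\<close>
  define ux where "ux = (\<lambda>q. fst (D q) / snd q)"
  define ut where "ut = (\<lambda>q. - (fst q / (snd q)\<^sup>2) * fst (D q))"
  define \<sigma>x where "\<sigma>x = (\<lambda>q. snd (D q) / snd q)"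
  define \<sigma>t where "\<sigma>t = (\<lambda>q. - (fst q / (snd q)\<^sup>2) * snd (D q))"
  have cont: "continuous_on S ux" "continuous_on S ut" "continuous_on S \<sigma>x" "continuous_on S \<sigma>t"
    unfolding ux_def ut_def \<sigma>x_def \<sigma>t_def using S(2)
    by (intro continuous_intros contD; force)+
  have pde: "((\<lambda>q. fst (U q)) has_derivative (\<lambda>(dx, dt). ux p * dx + ut p * dt)) (at p) \<and>
       ((\<lambda>q. snd (U q)) has_derivative (\<lambda>(dx, dt). \<sigma>x p * dx + \<sigma>t p * dt)) (at p) \<and>
       ut p + fst (U p) * ux p - \<sigma>x p = 0 \<and>
       \<sigma>t p + fst (U p) * \<sigma>x p - k\<^sup>2 * ux p = 0" if p: "p \<in> S" for p
  proof -
    define \<xi> where "\<xi> = fst p / snd p"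
    have t: "snd p > 0" using S[OF p] by simp
    obtain b where b: "(V has_vector_derivative b) (at \<xi>)"
      "(fst (V \<xi>) - \<xi>) * fst b = snd b" "(fst (V \<xi>) - \<xi>) * snd b = k\<^sup>2 * fst b"
      using S(3)[OF p] unfolding \<xi>_def by (rule regular_at_vector_derivative)
    have D: "D p = b"
      unfolding D_def \<xi>_def[symmetric] by (rule vector_derivative_at[OF b(1)])
    have "((\<lambda>q. fst q / snd q) has_derivative
        (\<lambda>h. fst h / snd p - fst p / (snd p)\<^sup>2 * snd h)) (at p)"
      using t by (auto intro!: derivative_eq_intros simp: fun_eq_iff field_simps power2_eq_square)
    from has_derivative_compose[OF this] b(1)
    have "((\<lambda>q. V (fst q / snd q)) has_derivative
        (\<lambda>h. (fst h / snd p - fst p / (snd p)\<^sup>2 * snd h) *\<^sub>R b)) (at p)"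
      unfolding has_vector_derivative_def \<xi>_def by blast
    moreover have "open {q :: real \<times> real. snd q > 0}"
      by (intro open_Collect_less continuous_intros)
    \<comment> \<open>\<open>U\<close> is tied to \<open>V\<close> only for positive time, so the
      derivative is transferred on that open half plane.\<close>
    ultimately have dU: "(U has_derivative
        (\<lambda>h. (fst h / snd p - fst p / (snd p)\<^sup>2 * snd h) *\<^sub>R b)) (at p)"
      using t by (elim has_derivative_transform_within_open) (auto simp: U)
    have "((\<lambda>q. fst (U q)) has_derivative (\<lambda>(dx, dt). ux p * dx + ut p * dt)) (at p)"
      using has_derivative_fst[OF dU]
      by (rule has_derivative_eq_rhs) (auto simp: fun_eq_iff ux_def ut_def D field_simps)
    moreover have "((\<lambda>q. snd (U q)) has_derivative (\<lambda>(dx, dt). \<sigma>x p * dx + \<sigma>t p * dt)) (at p)"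
      using has_derivative_snd[OF dU]
      by (rule has_derivative_eq_rhs) (auto simp: fun_eq_iff \<sigma>x_def \<sigma>t_def D field_simps)
    \<comment> \<open>Pulling out the factor 1 / t leaves the rows of (A(V) - \<xi>) b, which vanish
      by regularity.\<close>
    moreover have "ut p + fst (U p) * ux p - \<sigma>x p =
        ((fst (V \<xi>) - \<xi>) * fst b - snd b) / snd p"
      using t by (simp add: ut_def ux_def \<sigma>x_def D U \<xi>_def field_simps power2_eq_square)
    moreover have "\<sigma>t p + fst (U p) * \<sigma>x p - k\<^sup>2 * ux p =
        ((fst (V \<xi>) - \<xi>) * snd b - k\<^sup>2 * fst b) / snd p"
      using t by (simp add: \<sigma>t_def ux_def \<sigma>x_def D U \<xi>_def[symmetric] field_simps power2_eq_square)
        (simp add: \<xi>_def field_simps)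
    ultimately show ?thesis using b(2,3) by simp
  qed
  have jump: "\<forall>\<gamma>\<in>\<Gamma>. \<forall>t. (\<gamma> t, t) \<in> quarter_plane \<longrightarrow>
      (\<exists>UL UR.
        (U \<longlongrightarrow> UL) (at (\<gamma> t, t) within {(y, \<tau>). y < \<gamma> \<tau>}) \<and>
        (U \<longlongrightarrow> UR) (at (\<gamma> t, t) within {(y, \<tau>). \<gamma> \<tau> < y}) \<and>
        (if UL = UR then U (\<gamma> t, t) = UL else \<exists>j. lax_shock k j (deriv \<gamma> t) UL UR))"
  proof (intro ballI allI impI)
    fix \<gamma> t assume \<gamma>: "\<gamma> \<in> \<Gamma>" and \<Omega>: "(\<gamma> t, t) \<in> quarter_plane"
    obtain s where s: "\<gamma> = (\<lambda>t. s * t)" using \<gamma> by (auto simp: \<Gamma>_def)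
    have t: "t > 0" using \<Omega> by (simp add: quarter_plane_def)
    obtain UL UR where L: "(V \<longlongrightarrow> UL) (at_left s)" and R: "(V \<longlongrightarrow> UR) (at_right s)"
      and J: "if UL = UR then V s = UL else \<exists>j. lax_shock k j s UL UR"
      using V by (rule admissible_profile_one_sided_limits)
    have "(U \<longlongrightarrow> UL) (at (s * t, t) within {(y, \<tau>). y < s * \<tau>})"
      by (rule tendsto_self_similar[OF L t _ U]) (auto simp: field_simps)
    moreover have "(U \<longlongrightarrow> UR) (at (s * t, t) within {(y, \<tau>). s * \<tau> < y})"
      by (rule tendsto_self_similar[OF R t _ U]) (auto simp: field_simps)
    moreover have "U (s * t, t) = V s" using t by (simp add: U)
    ultimately show "\<exists>UL UR.
        (U \<longlongrightarrow> UL) (at (\<gamma> t, t) within {(y, \<tau>). y < \<gamma> \<tau>}) \<and>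
        (U \<longlongrightarrow> UR) (at (\<gamma> t, t) within {(y, \<tau>). \<gamma> \<tau> < y}) \<and>
        (if UL = UR then U (\<gamma> t, t) = UL else \<exists>j. lax_shock k j (deriv \<gamma> t) UL UR)"
      using J unfolding s by (intro exI[of _ UL] exI[of _ UR]) simp
  qed
  have "finite \<Gamma>"
    using V by (simp add: \<Gamma>_def P_def admissible_profile_def)
  moreover have "\<forall>\<gamma>\<in>\<Gamma>. \<gamma> differentiable_on UNIV \<and> continuous_on UNIV (deriv \<gamma>)"
    by (auto simp: \<Gamma>_def intro!: derivative_intros)
  moreover have "\<exists>ux ut \<sigma>x \<sigma>t :: real \<times> real \<Rightarrow> real.
      continuous_on S ux \<and> continuous_on S ut \<and> continuous_on S \<sigma>x \<and> continuous_on S \<sigma>t \<and>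
      (\<forall>p\<in>S.
         ((\<lambda>q. fst (U q)) has_derivative (\<lambda>(dx, dt). ux p * dx + ut p * dt)) (at p) \<and>
         ((\<lambda>q. snd (U q)) has_derivative (\<lambda>(dx, dt). \<sigma>x p * dx + \<sigma>t p * dt)) (at p) \<and>
         ut p + fst (U p) * ux p - \<sigma>x p = 0 \<and>
         \<sigma>t p + fst (U p) * \<sigma>x p - k\<^sup>2 * ux p = 0)"
    by (rule exI[of _ ux], rule exI[of _ ut], rule exI[of _ \<sigma>x], rule exI[of _ \<sigma>t])
      ((rule conjI, rule cont)+, rule ballI, rule pde)
  ultimately show ?thesis
    unfolding volpert_solution_def Let_def S_def using jump
    by (intro exI[of _ \<Gamma>] conjI)
qed

section \<open>Initial and boundary data of the restricted Riemann solution\<close>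

theorem theorem2p1:
  fixes k ub \<sigma>b u0 \<sigma>0 :: real
  assumes "k > 0"
    and "\<exists>V. riemann_solution k (ub, \<sigma>b) (u0, \<sigma>0) V"
  shows "\<exists>U. volpert_solution k quarter_plane U \<and>
             initial_condition U (u0, \<sigma>0) \<and>
             boundary_condition k U (ub, \<sigma>b) \<and>
             consists_of_waves k U"
proof -
  obtain V where V: "riemann_solution k (ub, \<sigma>b) (u0, \<sigma>0) V"
    using assms(2) by blast
  then obtain js where fan: "wave_fan k js (ub, \<sigma>b) (u0, \<sigma>0) V"
    unfolding riemann_solution_def by blast
  have adm: "admissible_profile k V"
    using fan by (rule admissible_profile_wave_fan)
  \<comment> \<open>The initial state must be set by hand at t = 0: there \<open>x / 0 = 0\<close>
    would produce \<open>V 0\<close> instead.\<close>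
  define U where "U = (\<lambda>q. if snd q > 0 then V (fst q / snd q) else (u0, \<sigma>0))"
  obtain M where M: "\<And>\<xi>. \<xi> > M \<Longrightarrow> V \<xi> = (u0, \<sigma>0)"
    using wave_fan_right_state[OF fan] by blast
  have "(U \<longlongrightarrow> (u0, \<sigma>0)) (at (x, 0) within quarter_plane)" if "x > 0" for x
  proof (rule tendsto_eventually)
    \<comment> \<open>The condition x / t > M is written as x - M t > 0, which stays continuous at t
      = 0 and has the positive limit x there.\<close>
    have "((\<lambda>q. fst q - M * snd q) \<longlongrightarrow> fst (x, 0::real) - M * snd (x, 0))
        (at (x, 0) within quarter_plane)"
      by (intro tendsto_diff tendsto_mult_left tendsto_fst[OF tendsto_ident_at]
          tendsto_snd[OF tendsto_ident_at])
    then have "\<forall>\<^sub>F q in at (x, 0) within quarter_plane. 0 < fst q - M * snd q"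
      using that by (intro order_tendstoD(1)) auto
    then show "\<forall>\<^sub>F q in at (x, 0) within quarter_plane. U q = (u0, \<sigma>0)"
    proof (rule eventually_mono)
      fix q :: "real \<times> real"
      assume "0 < fst q - M * snd q"
      then have "V (fst q / snd q) = (u0, \<sigma>0)" if "snd q > 0"
        using that by (intro M) (simp add: field_simps)
      then show "U q = (u0, \<sigma>0)" by (simp add: U_def)
    qed
  qed
  then have "initial_condition U (u0, \<sigma>0)"
    by (simp add: initial_condition_def U_def)
  moreover have "boundary_condition k U (ub, \<sigma>b)"
  proof -
    obtain v where v: "(V \<longlongrightarrow> v) (at_right 0)"
      using adm by (rule admissible_profile_one_sided_limits)
    then have "v \<in> ER k (ub, \<sigma>b)"
      using V unfolding ER_def by blast
    moreover have "((\<lambda>x. U (x, t)) \<longlongrightarrow> v) (at_right 0)" if "t > 0" for t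
    proof -
      have "((\<lambda>x. x / t) \<longlongrightarrow> 0 / t) (at_right 0)"
        using that by (intro tendsto_intros) auto
      \<comment> \<open>Division by a positive \<open>t\<close> preserves the approach from the
        right, which matters when \<open>V\<close> jumps at 0.\<close>
      then have "filterlim (\<lambda>x. x / t) (at_right 0) (at_right 0)"
        using that by (auto simp: filterlim_at eventually_at_filter)
      then show ?thesis
        using that filterlim_compose[OF v] by (simp add: U_def)
    qed
    ultimately show ?thesis
      unfolding boundary_condition_def by blast
  qed
  moreover have "volpert_solution k quarter_plane U"
    using adm by (rule volpert_solution_self_similar) (simp add: U_def)
  moreover have "consists_of_waves k U"
    unfolding consists_of_waves_def by (intro exI conjI, rule fan) (simp add: U_def)
  ultimately show ?thesis by blast
qed

end
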